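(* Consider the polynomial regression model $y_h=f(t_h;c)+\varepsilon_h$, $h=1,\ldots,N$, of degree $n\ge1$, where $f(t;c)=c^\top\psi(t)=\sum_{i=0}^n c_it^i$ for $t\in T\subseteq\mathbb{R}$, $\psi(t)=(1,t,\ldots,t^n)^\top$, $c=(c_0,\ldots,c_n)^\top\in\mathbb{R}^{n+1}$ is the true parameter, and the errors $\varepsilon_h$ are independent $N(0,\sigma^2)$ with $\sigma^2$ known. Let $\widehat c$ be the ordinary least squares estimator of $c$, so that $\widehat c\sim N_{n+1}(c,\Sigma)$ with $\Sigma=\sigma^2\bigl(\sum_{h=1}^N\psi(t_h)\psi(t_h)^\top\bigr)^{-1}$. Let $\lambda_{12,\alpha}$ be the upper $\alpha$ percentile of the distribution, under $c=0$, of the statistic $\lambda_{12}=\Vert\widehat c\Vert^2_{\Sigma^{-1}}-\Vert\widehat c_K\Vert^2_{\Sigma^{-1}}$, where $\widehat c_K=\Pi_{\Sigma^{-1}}(\widehat c|K)$. Then the statement below holds with probability $1-\alpha$: $$\mu[f_c]\in\bigl(\mu[f_{\widehat c}]-\sqrt{\lambda_{12,\alpha}}\,\Vert\mu[\psi]\Vert_{\Sigma},\ \infty\bigr)\quad\text{for all nonnegative measures $\mu$ on $T$.}$$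
   Context: $K=\{c\in\mathbb{R}^{n+1}: c^\top\psi(t)\ge0\ \text{for all } t\in T\}$ is the closed convex cone of (coefficient vectors of) polynomials of degree at most $n$ that are nonnegative on $T$. For a positive definite matrix $Q$, $\Vert x\Vert_Q=\sqrt{x^\top Qx}$, and for a closed convex set $A$, $\Pi_Q(x|A)=\mathrm{argmin}_{y\in A}\Vert x-y\Vert_Q$ is the orthogonal projection of $x$ onto $A$. For a nonnegative measure $\mu$ on $T$, $\mu[\psi]=\int_T\psi(t)\,\mu(dt)\in\mathbb{R}^{n+1}$ and, for a coefficient vector $c$, $\mu[f_c]=\int_T f(t;c)\,\mu(dt)$ (likewise $\mu[f_{\widehat c}]=\int_T f(t;\widehat c)\,\mu(dt)$). The statistic $\lambda_{12}$ is the likelihood ratio test statistic for testing $H_1: c\in K$ against $H_2: c\in\mathbb{R}^{n+1}$ (unrestricted) when $\sigma^2$ is known.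
   Formalization: The zero measure is excluded (there the claim reads 0 in (0,∞), which is false), μ[ψ] is assumed finite, and α in (0,1) must be attained: P(λ_12 > λ_{12,α}) = α, as λ_12 may have an atom at 0; probability is taken in the completion. *)

theory Defs
  imports "HOL-Probability.Probability"
begin

text \<open>
  Coefficient vectors in \<open>\<real>\<^sup>n\<^sup>+\<^sup>1\<close> are elements of \<^typ>\<open>real ^ 'm\<close> with \<open>CARD('m) = n + 1\<close>.  The linear order
  on the index type only serves to label the coordinates by the exponents \<open>0, \<dots>, n\<close>.
\<close>

definition expo :: "'m::{finite,linorder} \<Rightarrow> nat" where
  "expo i = card {..<i}"

definition psi :: "real \<Rightarrow> real ^ 'm::{finite,linorder}" where
  "psi s = (\<chi> i. s ^ expo i)"

definition polyf :: "real ^ 'm::{finite,linorder} \<Rightarrow> real \<Rightarrow> real" where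
  "polyf c s = c \<bullet> psi s"

lemma bij_betw_expo:
  assumes "CARD('m::{finite,linorder}) = n + 1"
  shows "bij_betw (expo :: 'm \<Rightarrow> nat) UNIV {..n}"
proof -
  have mono: "expo i < expo j" if "i < j" for i j :: 'm
    unfolding expo_def using that by (intro psubset_card_mono) auto
  have inj: "inj (expo :: 'm \<Rightarrow> nat)"
    by (rule injI) (metis mono less_irrefl neq_iff)
  have "expo i < CARD('m)" for i :: 'm
    unfolding expo_def by (intro psubset_card_mono) auto
  then have "range (expo :: 'm \<Rightarrow> nat) \<subseteq> {..n}"
    using assms by (auto simp: less_Suc_eq_le)
  moreover have "card (range (expo :: 'm \<Rightarrow> nat)) = card {..n}"
    using assms by (simp add: card_image[OF inj])
  ultimately have "range (expo :: 'm \<Rightarrow> nat) = {..n}"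
    by (intro card_subset_eq) auto
  with inj show ?thesis by (simp add: bij_betw_def)
qed

lemma polyf_eq_sum:
  fixes c :: "real ^ 'm::{finite,linorder}"
  assumes "CARD('m) = n + 1"
  shows "polyf c s = (\<Sum>i\<le>n. c $ (inv expo i) * s ^ i)"
proof -
  note b = bij_betw_expo[where ?'m = 'm, OF assms]
  have "polyf c s = (\<Sum>i\<in>UNIV. c $ i * s ^ expo i)"
    by (simp add: polyf_def psi_def inner_vec_def)
  also have "\<dots> = (\<Sum>i\<in>(UNIV :: 'm set). c $ (inv expo (expo i)) * s ^ expo i)"
    using bij_betw_imp_inj_on[OF b] by (simp add: inv_f_f)
  also have "\<dots> = (\<Sum>i\<le>n. c $ (inv expo i) * s ^ i)"
    by (rule sum.reindex_bij_betw[OF b])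
  finally show ?thesis .
qed

definition nonneg_cone :: "real set \<Rightarrow> (real ^ 'm::{finite,linorder}) set" where
  "nonneg_cone T = {c. \<forall>s\<in>T. 0 \<le> polyf c s}"

definition qnorm :: "real ^ 'm ^ 'm \<Rightarrow> real ^ 'm \<Rightarrow> real" where
  "qnorm Q x = sqrt (x \<bullet> (Q *v x))"

definition qproj :: "real ^ 'm ^ 'm \<Rightarrow> real ^ 'm \<Rightarrow> (real ^ 'm) set \<Rightarrow> real ^ 'm" where
  "qproj Q x A = (ARG_MIN (\<lambda>y. qnorm Q (x - y)) y. y \<in> A)"

definition gram :: "nat \<Rightarrow> (nat \<Rightarrow> real) \<Rightarrow> real ^ 'm::{finite,linorder} ^ 'm::{finite,linorder}" where
  "gram N t = (\<Sum>h=1..N. \<chi> i j. psi (t h) $ i * psi (t h) $ j)"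

definition covm :: "real \<Rightarrow> nat \<Rightarrow> (nat \<Rightarrow> real) \<Rightarrow> real ^ 'm::{finite,linorder} ^ 'm::{finite,linorder}" where
  "covm \<sigma> N t = \<sigma>\<^sup>2 *\<^sub>R matrix_inv (gram N t)"

definition response ::
    "(nat \<Rightarrow> real) \<Rightarrow> (nat \<Rightarrow> 'a \<Rightarrow> real) \<Rightarrow> real ^ 'm::{finite,linorder} \<Rightarrow> nat \<Rightarrow> 'a \<Rightarrow> real" where
  "response t \<epsilon> c h \<omega> = polyf c (t h) + \<epsilon> h \<omega>"

definition ols :: "nat \<Rightarrow> (nat \<Rightarrow> real) \<Rightarrow> (nat \<Rightarrow> real) \<Rightarrow> real ^ 'm::{finite,linorder}" where
  "ols N t y = (ARG_MIN (\<lambda>b. \<Sum>h=1..N. (y h - polyf b (t h))\<^sup>2) b. True)"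

definition chat ::
    "nat \<Rightarrow> (nat \<Rightarrow> real) \<Rightarrow> (nat \<Rightarrow> 'a \<Rightarrow> real) \<Rightarrow> real ^ 'm::{finite,linorder} \<Rightarrow> 'a \<Rightarrow> real ^ 'm::{finite,linorder}" where
  "chat N t \<epsilon> c \<omega> = ols N t (\<lambda>h. response t \<epsilon> c h \<omega>)"

definition lambda12 ::
    "real set \<Rightarrow> real ^ 'm::{finite,linorder} ^ 'm::{finite,linorder} \<Rightarrow> real ^ 'm::{finite,linorder} \<Rightarrow> real" where
  "lambda12 T S x =
     (qnorm (matrix_inv S) x)\<^sup>2 -
     (qnorm (matrix_inv S) (qproj (matrix_inv S) x (nonneg_cone T)))\<^sup>2"

text \<open>
  The law of \<^const>\<open>lambda12\<close> may have an atom at \<open>0\<close>, so not every level is attained; an upper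
  percentile is therefore a relation rather than a generalised inverse.
\<close>

definition is_upper_percentile :: "'a measure \<Rightarrow> ('a \<Rightarrow> real) \<Rightarrow> real \<Rightarrow> real \<Rightarrow> bool" where
  "is_upper_percentile M X \<alpha> q \<longleftrightarrow> measure M {\<omega> \<in> space M. q < X \<omega>} = \<alpha>"

definition measure_on :: "real set \<Rightarrow> real measure \<Rightarrow> bool" where
  "measure_on T \<mu> \<longleftrightarrow> sets \<mu> = sets (restrict_space borel T)"

text \<open>
  The measures admitted below have \<open>\<mu>[\<psi>]\<close> finite and are nonzero: for \<open>\<mu> = 0\<close> the
  open interval is \<open>(0, \<infinity>)\<close>, which does not contain \<open>\<mu>[f\<^sub>c] = 0\<close>.
  Since the quantifier over \<open>\<mu>\<close> is uncountable and \<open>T\<close> is arbitrary, the resulting event is to be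
  measured in the completion of the underlying probability space.
\<close>

definition confidence_statement ::
    "real set \<Rightarrow> real ^ 'm::{finite,linorder} ^ 'm::{finite,linorder} \<Rightarrow> real \<Rightarrow>
       real ^ 'm::{finite,linorder} \<Rightarrow> real ^ 'm::{finite,linorder} \<Rightarrow> bool" where
  "confidence_statement T S q c x \<longleftrightarrow>
     (\<forall>\<mu>. measure_on T \<mu> \<longrightarrow> emeasure \<mu> T \<noteq> 0 \<longrightarrow>
        integrable \<mu> (psi :: real \<Rightarrow> real ^ 'm::{finite,linorder}) \<longrightarrow>
        (LINT s|\<mu>. polyf c s) \<in>
          {(LINT s|\<mu>. polyf x s) - sqrt q * qnorm S (LINT s|\<mu>. psi s)<..})"

end

theory Submission
  imports Defs
begin

text \<open>
  Write \<open>e\<close> for the estimation error and \<open>A\<close> for the closed set of all \<open>x\<close> with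
  \<open>x \<bullet> m \<le> sqrt lam * qnorm \<Sigma> m\<close> for every moment vector \<open>m = \<mu>[\<psi>]\<close>.  The moment
  vectors together with \<open>0\<close> are dense in the dual of the cone \<open>K\<close>, so the Moreau decomposition along
  \<open>K\<close> shows that \<open>\<lambda>\<^sub>1\<^sub>2(x) \<le> lam\<close> iff \<open>- x \<in> A\<close>; as \<open>e\<close> is symmetric, \<open>e \<in> A\<close> has probability
  \<open>1 - \<alpha>\<close>.

  The confidence statement is the strict version of \<open>e \<in> A\<close>.  Subtracting a positive constant
  polynomial from a point of \<open>A\<close> makes all inequalities strict, so the two events differ by a set
  that, in the space of the noise vector, meets each line parallel to \<open>(1, \<dots>, 1)\<close> in at most one
  point.  Such a set is Lebesgue null by translation invariance and Fubini's theorem.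
\<close>


section \<open>Projections in the norm of a positive definite matrix\<close>

lemma matrix_inv_cancel:
  fixes A :: "real ^ 'm ^ 'm"
  assumes "invertible A"
  shows "A ** matrix_inv A = mat 1" and "matrix_inv A ** A = mat 1"
proof -
  have "\<exists>B. A ** B = mat 1 \<and> B ** A = mat 1"
    using assms by (simp add: invertible_def)
  from someI_ex[OF this] show "A ** matrix_inv A = mat 1" "matrix_inv A ** A = mat 1"
    by (simp_all add: matrix_inv_def)
qed

lemma matrix_inv_eqI:
  fixes A B :: "real ^ 'm ^ 'm"
  assumes "A ** B = mat 1"
  shows "matrix_inv A = B"
proof -
  have BA: "B ** A = mat 1"
    using assms matrix_left_right_inverse by blast
  then have "invertible A"
    using assms by (auto simp: invertible_def)
  then have "matrix_inv A ** (A ** B) = B"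
    by (simp add: matrix_mul_assoc matrix_inv_cancel)
  then show ?thesis
    by (simp add: assms)
qed

text \<open>Divide by \<open>r\<close> and let \<open>r\<close> tend to 0. This is the first-order
  condition behind the variational inequality of a projection.\<close>

lemma nonpos_if_linear_le_quadratic:
  fixes a b :: real
  assumes "\<And>r. 0 < r \<Longrightarrow> r \<le> 1 \<Longrightarrow> r * a \<le> r\<^sup>2 * b"
  shows "a \<le> 0"
proof (rule ccontr)
  assume "\<not> a \<le> 0"
  then have a: "0 < a" by simp
  \<comment> \<open>Small enough for the quadratic term to use up only half of \<open>a\<close>; the
    \<open>+ 1\<close> keeps the denominator positive when \<open>b = 0\<close>.\<close>
  define r where "r = min 1 (a / (2 * (\<bar>b\<bar> + 1)))"
  have r: "0 < r" "r \<le> 1" "r \<le> a / (2 * (\<bar>b\<bar> + 1))"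
    using a by (auto simp: r_def)
  have "a \<le> r * b"
    using assms[OF r(1,2)] r(1) by (simp add: power2_eq_square)
  also have "\<dots> \<le> r * (\<bar>b\<bar> + 1)"
    using r(1) by (intro mult_left_mono) auto
  also have "\<dots> \<le> a / 2"
    using r(3) by (simp add: field_simps)
  finally show False using a by simp
qed

lemma continuous_on_qnorm [continuous_intros]:
  "continuous_on X f \<Longrightarrow> continuous_on X (\<lambda>x. qnorm R (f x))"
  unfolding qnorm_def
  by (intro continuous_intros bounded_linear.continuous_on[OF matrix_vector_mul_bounded_linear])

locale pos_def_matrix =
  fixes Q :: "real ^ 'm ^ 'm"
  assumes sym: "x \<bullet> (Q *v y) = y \<bullet> (Q *v x)"
    and pos: "x \<noteq> 0 \<Longrightarrow> 0 < x \<bullet> (Q *v x)"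
begin

lemma nonneg: "0 \<le> x \<bullet> (Q *v x)"
  using pos[of x] by (cases "x = 0") auto

lemma qnorm_power2: "(qnorm Q x)\<^sup>2 = x \<bullet> (Q *v x)"
  by (simp add: qnorm_def nonneg)

lemma qnorm_nonneg: "0 \<le> qnorm Q x"
  by (simp add: qnorm_def nonneg)

text \<open>Serves three purposes: the optimal \<open>r\<close> gives Cauchy-Schwarz, small
  \<open>r\<close> the variational inequality, and \<open>r = 1\<close> both Pythagoras and the
  evenness of \<open>qnorm\<close>.\<close>

lemma quadratic_diff:
  "(x - r *\<^sub>R y) \<bullet> (Q *v (x - r *\<^sub>R y)) =
     x \<bullet> (Q *v x) - 2 * r * (y \<bullet> (Q *v x)) + r\<^sup>2 * (y \<bullet> (Q *v y))"
  using sym[of x y]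
  by (simp add: matrix_vector_mult_diff_distrib matrix_vector_mult_scaleR inner_diff_left
      inner_diff_right power2_eq_square algebra_simps)

lemma cauchy_schwarz: "x \<bullet> (Q *v y) \<le> qnorm Q x * qnorm Q y"
proof (cases "y = 0")
  case False
  let ?b = "y \<bullet> (Q *v y)"
  have b: "0 < ?b" using pos False by blast
  define d where "d = x \<bullet> (Q *v y)"
  \<comment> \<open>The factor \<open>d / ?b\<close> minimises the quadratic in \<open>r\<close>
    from \<open>quadratic_diff\<close>.\<close>
  have "0 \<le> x \<bullet> (Q *v x) - 2 * (d / ?b) * d + (d / ?b)\<^sup>2 * ?b"
    using nonneg[of "x - (d / ?b) *\<^sub>R y"] sym[of x y] by (simp add: quadratic_diff d_def)
  also have "\<dots> = x \<bullet> (Q *v x) - d\<^sup>2 / ?b"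
    using b by (simp add: power2_eq_square field_simps)
  finally have "d\<^sup>2 \<le> (qnorm Q x * qnorm Q y)\<^sup>2"
    using b by (simp add: power_mult_distrib qnorm_power2 field_simps)
  then show ?thesis
    unfolding d_def by (rule power2_le_imp_le) (simp add: qnorm_nonneg)
qed (simp add: qnorm_nonneg)

lemma invertible_Q: "invertible Q"
  unfolding invertible_left_inverse matrix_left_invertible_ker
  using pos by force

lemma matrix_inv_inv: "matrix_inv (matrix_inv Q) = Q"
  by (rule matrix_inv_eqI) (rule matrix_inv_cancel(2)[OF invertible_Q])

lemma inv_mult [simp]: "matrix_inv Q *v (Q *v x) = x"
  by (simp add: matrix_vector_mul_assoc matrix_inv_cancel invertible_Q)

lemma mult_inv [simp]: "Q *v (matrix_inv Q *v x) = x"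
  by (simp add: matrix_vector_mul_assoc matrix_inv_cancel invertible_Q)

text \<open>Multiplication by \<open>Q\<close> is an isometry from coefficient vectors to moment
  vectors with the dual norm.\<close>

lemma qnorm_inv: "qnorm (matrix_inv Q) (Q *v x) = qnorm Q x"
  by (simp add: qnorm_def inner_commute)

lemma qnorm_inv_pos: "x \<noteq> 0 \<Longrightarrow> 0 < qnorm (matrix_inv Q) x"
  using pos[of "matrix_inv Q *v x"] mult_inv[of x] 
  by (auto simp: qnorm_def inner_commute simp del: mult_inv)
     (metis mult_inv matrix_vector_mult_0_right inner_commute)

lemma cauchy_schwarz_dual: "x \<bullet> m \<le> qnorm Q x * qnorm (matrix_inv Q) m"
  using cauchy_schwarz[of x "matrix_inv Q *v m"] qnorm_inv[of "matrix_inv Q *v m"] by simp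

text \<open>The minimum over the compact unit sphere is positive, and homogeneity carries it to all
  vectors. It makes the sublevel sets of \<open>qnorm\<close> bounded.\<close>

lemma norm_le_qnorm: obtains k where "0 < k" "\<And>x. k * norm x \<le> qnorm Q x"
proof -
  have "compact (sphere (0 :: real ^ 'm) 1)" "sphere (0 :: real ^ 'm) 1 \<noteq> {}"
    by auto
  then obtain u where u: "u \<in> sphere 0 1" and min: "\<And>y. y \<in> sphere 0 1 \<Longrightarrow> qnorm Q u \<le> qnorm Q y"
    using continuous_attains_inf[of "sphere 0 1" "qnorm Q"] continuous_on_qnorm[OF continuous_on_id]
    by metis
  have scale: "qnorm Q (r *\<^sub>R x) = \<bar>r\<bar> * qnorm Q x" for r x
    by (simp add: qnorm_def matrix_vector_mult_scaleR real_sqrt_mult flip: mult.assoc)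
  have "qnorm Q u * norm x \<le> qnorm Q x" for x
  proof (cases "x = 0")
    case False
    then have "qnorm Q u \<le> qnorm Q (x /\<^sub>R norm x)"
      by (intro min) simp
    with False show ?thesis
      by (simp add: scale field_simps)
  qed (simp add: qnorm_nonneg)
  moreover have "0 < qnorm Q u"
    using u pos[of u] by (cases "u = 0") (auto simp: qnorm_def)
  ultimately show thesis using that by blast
qed

text \<open>\<open>ARG_MIN\<close> is meaningful only once a minimiser is known to exist; it comes
  from compactness of the part of \<open>A\<close> at least as close to \<open>x\<close> as
  \<open>a\<close>.\<close>

lemma qproj_min:
  assumes "closed A" "a \<in> A"
  shows "qproj Q x A \<in> A" and "\<And>y. y \<in> A \<Longrightarrow> qnorm Q (x - qproj Q x A) \<le> qnorm Q (x - y)"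
proof -
  obtain k where k: "0 < k" "\<And>x. k * norm x \<le> qnorm Q x"
    by (rule norm_le_qnorm) blast
  define B where "B = A \<inter> {y. qnorm Q (x - y) \<le> qnorm Q (x - a)}"
  have "closed B"
    unfolding B_def by (intro closed_Int assms closed_Collect_le continuous_intros)
  moreover have "B \<subseteq> cball x (qnorm Q (x - a) / k)"
  proof
    fix y assume "y \<in> B"
    then have "k * norm (x - y) \<le> qnorm Q (x - a)"
      using k(2)[of "x - y"] by (simp add: B_def)
    then show "y \<in> cball x (qnorm Q (x - a) / k)"
      using k(1) by (simp add: dist_norm field_simps)
  qed
  ultimately have "compact B"
    by (meson bounded_cball bounded_subset compact_eq_bounded_closed)
  moreover have "a \<in> B" using assms by (simp add: B_def)
  moreover have "continuous_on B (\<lambda>y. qnorm Q (x - y))"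
    by (intro continuous_intros)
  ultimately obtain p where p: "p \<in> B" "\<And>y. y \<in> B \<Longrightarrow> qnorm Q (x - p) \<le> qnorm Q (x - y)"
    using continuous_attains_inf[of B "\<lambda>y. qnorm Q (x - y)"] by blast
  have "is_arg_min (\<lambda>y. qnorm Q (x - y)) (\<lambda>y. y \<in> A) p"
    using p unfolding is_arg_min_linorder B_def by (smt (verit) IntE IntI mem_Collect_eq)
  then have "is_arg_min (\<lambda>y. qnorm Q (x - y)) (\<lambda>y. y \<in> A) (qproj Q x A)"
    unfolding qproj_def arg_min_def by (rule someI)
  then show "qproj Q x A \<in> A" and "\<And>y. y \<in> A \<Longrightarrow> qnorm Q (x - qproj Q x A) \<le> qnorm Q (x - y)"
    by (auto simp: is_arg_min_linorder)
qed

text \<open>Moreau decomposition: \<open>x - p\<close> is orthogonal to \<open>p\<close> and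
  \<open>Q *v (x - p)\<close> lies in the polar cone, because no admissible move away from
  \<open>p\<close> can shorten the distance to \<open>x\<close>.\<close>

lemma qproj_cone:
  fixes x :: "real ^ 'm"
  assumes A: "closed A" "0 \<in> A" and add: "\<And>u v. u \<in> A \<Longrightarrow> v \<in> A \<Longrightarrow> u + v \<in> A"
    and scale: "\<And>r u. 0 \<le> r \<Longrightarrow> u \<in> A \<Longrightarrow> r *\<^sub>R u \<in> A"
  defines "p \<equiv> qproj Q x A"
  shows "p \<in> A" and "\<And>y. y \<in> A \<Longrightarrow> y \<bullet> (Q *v (x - p)) \<le> 0" and "p \<bullet> (Q *v (x - p)) = 0"
    and "(qnorm Q x)\<^sup>2 - (qnorm Q p)\<^sup>2 = (qnorm Q (x - p))\<^sup>2"
proof -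
  note min = qproj_min[OF A, where x = x, folded p_def]
  show pA: "p \<in> A" by (rule min(1))
  have var: "y \<bullet> (Q *v (x - p)) \<le> 0" if y: "\<And>r. 0 < r \<Longrightarrow> r \<le> 1 \<Longrightarrow> p + r *\<^sub>R y \<in> A" for y
  proof -
    have "2 * (y \<bullet> (Q *v (x - p))) \<le> 0"
    proof (rule nonpos_if_linear_le_quadratic)
      fix r :: real assume r: "0 < r" "r \<le> 1"
      have "(qnorm Q (x - p))\<^sup>2 \<le> (qnorm Q (x - p - r *\<^sub>R y))\<^sup>2"
        using min(2)[OF y[OF r]] by (intro power_mono) (simp_all add: qnorm_nonneg algebra_simps)
      then show "r * (2 * (y \<bullet> (Q *v (x - p)))) \<le> r\<^sup>2 * (y \<bullet> (Q *v y))"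
        by (simp add: qnorm_power2 quadratic_diff)
    qed
    then show ?thesis by simp
  qed
  show "y \<bullet> (Q *v (x - p)) \<le> 0" if "y \<in> A" for y
    using that by (intro var add scale pA) auto
  \<comment> \<open>In a cone one may also move from \<open>p\<close> towards the origin; together
    with the direction \<open>p\<close> this gives equality.\<close>
  have "p + r *\<^sub>R (- p) = (1 - r) *\<^sub>R p" for r
    by (simp add: algebra_simps)
  then have "(- p) \<bullet> (Q *v (x - p)) \<le> 0"
    by (intro var) (use scale pA in auto)
  moreover have "p \<bullet> (Q *v (x - p)) \<le> 0"
    by (intro var add scale pA) auto
  ultimately show orth: "p \<bullet> (Q *v (x - p)) = 0" by simp
  then have "p \<bullet> (Q *v x) = p \<bullet> (Q *v p)"
    by (simp add: matrix_vector_mult_diff_distrib inner_diff_right)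
  then show "(qnorm Q x)\<^sup>2 - (qnorm Q p)\<^sup>2 = (qnorm Q (x - p))\<^sup>2"
    using quadratic_diff[of x 1 p] by (simp add: qnorm_power2)
qed

end

section \<open>Least squares for polynomial regression\<close>

lemma gram_mult: "gram N t *v x = (\<Sum>h=1..N. (x \<bullet> psi (t h)) *\<^sub>R psi (t h))"
proof (rule vec_eq_iff[THEN iffD2, rule_format])
  fix i
  have "(gram N t *v x) $ i = (\<Sum>j\<in>UNIV. \<Sum>h=1..N. psi (t h) $ i * psi (t h) $ j * x $ j)"
    by (simp add: gram_def matrix_vector_mult_def sum_distrib_right)
  also have "\<dots> = (\<Sum>h=1..N. \<Sum>j\<in>UNIV. psi (t h) $ i * psi (t h) $ j * x $ j)"
    by (rule sum.swap)
  also have "\<dots> = (\<Sum>h=1..N. (x \<bullet> psi (t h)) *\<^sub>R psi (t h)) $ i"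
    by (simp add: inner_vec_def sum_distrib_left mult_ac)
  finally show "(gram N t *v x) $ i = (\<Sum>h=1..N. (x \<bullet> psi (t h)) *\<^sub>R psi (t h)) $ i" .
qed

lemma inner_gram: "x \<bullet> (gram N t *v y) = (\<Sum>h=1..N. (x \<bullet> psi (t h)) * (y \<bullet> psi (t h)))"
  by (simp add: gram_mult inner_sum_right mult.commute)

text \<open>The form is a sum of squares, and if all of them vanished then \<open>x\<close> would
  lie in the kernel. The factor \<open>r\<close> covers both least squares (1) and the inverse
  covariance (\<open>1 / \<sigma>\<^sup>2\<close>).\<close>

lemma pos_def_gram:
  assumes inv: "invertible (gram N t :: real ^ 'm::{finite,linorder} ^ 'm::{finite,linorder})" and "0 < r"
  shows "pos_def_matrix (r *\<^sub>R gram N t :: real ^ 'm::{finite,linorder} ^ 'm::{finite,linorder})"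
proof
  fix x y :: "real ^ 'm::{finite,linorder}"
  show "x \<bullet> ((r *\<^sub>R gram N t) *v y) = y \<bullet> ((r *\<^sub>R gram N t) *v x)"
    by (simp add: scaleR_matrix_vector_assoc[symmetric] inner_gram mult.commute)
  assume "x \<noteq> 0"
  then have "(gram N t *v x) \<noteq> 0"
    using inv unfolding invertible_left_inverse matrix_left_invertible_ker by blast
  then obtain h where h: "h \<in> {1..N}" "x \<bullet> psi (t h) \<noteq> 0"
    unfolding gram_mult by (metis (no_types, lifting) scaleR_zero_left sum.neutral)
  have "0 < (x \<bullet> psi (t h))\<^sup>2" using h by simp
  also have "\<dots> \<le> (\<Sum>h=1..N. (x \<bullet> psi (t h))\<^sup>2)"
    using h(1) by (intro member_le_sum) auto
  finally show "0 < x \<bullet> ((r *\<^sub>R gram N t) *v x)"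
    using \<open>0 < r\<close> by (simp add: scaleR_matrix_vector_assoc[symmetric] inner_gram power2_eq_square)
qed

text \<open>The solution of the normal equations, which unlike \<open>ols\<close> is visibly linear
  in the data.\<close>

definition lse :: "nat \<Rightarrow> (nat \<Rightarrow> real) \<Rightarrow> (nat \<Rightarrow> real) \<Rightarrow> real ^ 'm::{finite,linorder}" where
  "lse N t y = matrix_inv (gram N t) *v (\<Sum>h=1..N. y h *\<^sub>R psi (t h))"

text \<open>Permits replacing data on all naturals by their restriction to \<open>{1..N}\<close>, a
  point of the product space.\<close>

lemma lse_cong: "(\<And>h. h \<in> {1..N} \<Longrightarrow> y h = z h) \<Longrightarrow> lse N t y = lse N t z"
  unfolding lse_def by (metis (mono_tags, lifting) sum.cong)

lemma lse_add: "lse N t (\<lambda>h. y h + z h) = lse N t y + lse N t z"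
  by (simp add: lse_def scaleR_left_distrib sum.distrib matrix_vector_right_distrib)

lemma lse_eq_sum: "lse N t y = (\<Sum>h=1..N. y h *\<^sub>R (matrix_inv (gram N t) *v psi (t h)))"
  by (simp add: lse_def matrix_vector_mult_scaleR linear_sum[OF matrix_vector_mul_linear])

lemma measurable_lse:
  "(lse N t :: _ \<Rightarrow> real ^ 'm::{finite,linorder}) \<in> borel_measurable (PiM {1..N} (\<lambda>_. borel))"
proof -
  have "(\<lambda>y. \<Sum>h=1..N. y h *\<^sub>R (matrix_inv (gram N t) *v psi (t h)) :: real ^ 'm::{finite,linorder})
      \<in> borel_measurable (PiM {1..N} (\<lambda>_. borel))"
    by (intro borel_measurable_sum borel_measurable_scaleR measurable_component_singleton
        borel_measurable_const)
  then show ?thesis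
    by (simp add: lse_eq_sum[abs_def])
qed

lemma lse_uminus: "lse N t (\<lambda>h. - y h) = - lse N t y"
  by (simp add: lse_def sum_negf flip: vector_scaleR_matrix_ac)
     (metis (no_types, lifting) matrix_vector_mult_scaleR scaleR_minus1_left sum_negf)

lemma lse_polyf:
  fixes b :: "real ^ 'm::{finite,linorder}"
  assumes "invertible (gram N t :: real ^ 'm::{finite,linorder} ^ 'm::{finite,linorder})"
  shows "lse N t (\<lambda>h. polyf b (t h)) = b"
  unfolding lse_def polyf_def gram_mult[symmetric]
  by (simp add: matrix_vector_mul_assoc matrix_inv_cancel assms)

text \<open>Completing the square: the residual is orthogonal to all polynomials, so the excess sum
  of squares is the Gram form of \<open>d - ?b\<close>. Definiteness gives the uniqueness that pins
  down \<open>ARG_MIN\<close>.\<close>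

lemma ols_eq_lse:
  assumes inv: "invertible (gram N t :: real ^ 'm::{finite,linorder} ^ 'm::{finite,linorder})"
  shows "ols N t y = (lse N t y :: real ^ 'm::{finite,linorder})"
proof -
  let ?G = "gram N t :: real ^ 'm::{finite,linorder} ^ 'm::{finite,linorder}" and ?b = "lse N t y :: real ^ 'm::{finite,linorder}"
  interpret pos_def_matrix ?G
    using pos_def_gram[OF inv, of 1] by simp
  have Gb: "?G *v ?b = (\<Sum>h=1..N. y h *\<^sub>R psi (t h))"
    by (simp add: lse_def)
  have expand: "(\<Sum>h=1..N. (y h - polyf d (t h))\<^sup>2) =
      (\<Sum>h=1..N. (y h - polyf ?b (t h))\<^sup>2) + (d - ?b) \<bullet> (?G *v (d - ?b))" for d
  proof -
    have "(d - ?b) \<bullet> (?G *v ?b) = (\<Sum>h=1..N. y h * polyf (d - ?b) (t h))"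
      by (simp add: Gb polyf_def inner_sum_right)
    then have "(\<Sum>h=1..N. (y h - polyf ?b (t h)) * polyf (d - ?b) (t h)) = 0"
      by (simp add: inner_gram polyf_def sum_subtractf sum.distrib algebra_simps)
    moreover have "(y h - polyf d (t h))\<^sup>2 = (y h - polyf ?b (t h))\<^sup>2
        - 2 * ((y h - polyf ?b (t h)) * polyf (d - ?b) (t h)) + (polyf (d - ?b) (t h))\<^sup>2" for h
      by (simp add: polyf_def inner_diff_left power2_eq_square algebra_simps)
    ultimately show ?thesis
      by (simp add: sum.distrib sum_subtractf inner_gram polyf_def power2_eq_square
          flip: sum_distrib_left)
  qed
  show ?thesis
    unfolding ols_def
  proof (rule arg_minI[where P = "\<lambda>_. True"])
    show "\<not> (\<Sum>h=1..N. (y h - polyf d (t h))\<^sup>2) < (\<Sum>h=1..N. (y h - polyf ?b (t h))\<^sup>2)"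
      for d :: "real ^ 'm::{finite,linorder}"
      using expand[of d] nonneg[of "d - ?b"] by linarith
  next
    fix d :: "real ^ 'm::{finite,linorder}"
    assume "\<forall>b :: real ^ 'm::{finite,linorder}. True \<longrightarrow>
      \<not> (\<Sum>h=1..N. (y h - polyf b (t h))\<^sup>2) < (\<Sum>h=1..N. (y h - polyf d (t h))\<^sup>2)"
    then have "\<not> (\<Sum>h=1..N. (y h - polyf ?b (t h))\<^sup>2) < (\<Sum>h=1..N. (y h - polyf d (t h))\<^sup>2)"
      by blast
    then have "(d - ?b) \<bullet> (?G *v (d - ?b)) \<le> 0"
      using expand[of d] by linarith
    then show "d = ?b"
      using pos[of "d - ?b"] by fastforce
  qed simp
qed

text \<open>The error does not depend on \<open>c\<close>, so a percentile taken under
  \<open>c = 0\<close> is usable for every true \<open>c\<close>.\<close>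

lemma chat_eq:
  fixes c :: "real ^ 'm::{finite,linorder}"
  assumes "invertible (gram N t :: real ^ 'm::{finite,linorder} ^ 'm::{finite,linorder})"
  shows "chat N t \<epsilon> c \<omega> = c + lse N t (\<lambda>h. \<epsilon> h \<omega>)"
  by (simp add: chat_def response_def ols_eq_lse lse_add lse_polyf assms)

lemma covm_eq:
  assumes inv: "invertible (gram N t :: real ^ 'm::{finite,linorder} ^ 'm::{finite,linorder})" and "0 < \<sigma>"
  shows "covm \<sigma> N t = matrix_inv ((1 / \<sigma>\<^sup>2) *\<^sub>R gram N t :: real ^ 'm::{finite,linorder} ^ 'm::{finite,linorder})"
proof -
  let ?G = "gram N t :: real ^ 'm::{finite,linorder} ^ 'm::{finite,linorder}"
  have "(((1 / \<sigma>\<^sup>2) *\<^sub>R ?G) ** (\<sigma>\<^sup>2 *\<^sub>R matrix_inv ?G)) *v x = x" for x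
  proof -
    have "(((1 / \<sigma>\<^sup>2) *\<^sub>R ?G) ** (\<sigma>\<^sup>2 *\<^sub>R matrix_inv ?G)) *v x =
        (\<sigma>\<^sup>2 * (1 / \<sigma>\<^sup>2)) *\<^sub>R ((?G ** matrix_inv ?G) *v x)"
      unfolding matrix_vector_mul_assoc[symmetric] scaleR_matrix_vector_assoc[symmetric]
        matrix_vector_mult_scaleR scaleR_scaleR ..
    then show ?thesis
      using \<open>0 < \<sigma>\<close> by (simp add: matrix_inv_cancel[OF inv])
  qed
  then show ?thesis
    unfolding covm_def by (intro matrix_inv_eqI[symmetric]) (simp add: matrix_eq)
qed


section \<open>Product measures with densities\<close>

text \<open>Both measures agree on boxes, where the integrand factors over the coordinates.\<close>

lemma PiM_density_eq:
  fixes f :: "real \<Rightarrow> ennreal"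
  assumes [simp]: "finite I" and f [measurable]: "f \<in> borel_measurable borel"
    and prob: "prob_space (density lborel f)"
  shows "PiM I (\<lambda>_. density lborel f) = density (PiM I (\<lambda>_. lborel)) (\<lambda>x. \<Prod>i\<in>I. f (x i))"
proof -
  interpret L: product_sigma_finite "\<lambda>_. lborel :: real measure" by standard
  interpret D: prob_space "density lborel f" by fact
  interpret D: product_sigma_finite "\<lambda>_. density lborel f" by standard
  show ?thesis
  proof (rule D.PiM_eqI[symmetric])
    show "sets (density (PiM I (\<lambda>_. lborel)) (\<lambda>x. \<Prod>i\<in>I. f (x i))) = sets (PiM I (\<lambda>_. density lborel f))"
      unfolding sets_density by (intro sets_PiM_cong) auto
  next
    fix A :: "_ \<Rightarrow> real set" assume A: "\<And>i. i \<in> I \<Longrightarrow> A i \<in> sets (density lborel f)"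
    have "emeasure (density (PiM I (\<lambda>_. lborel)) (\<lambda>x. \<Prod>i\<in>I. f (x i))) (Pi\<^sub>E I A) =
        (\<integral>\<^sup>+x. (\<Prod>i\<in>I. f (x i)) * indicator (Pi\<^sub>E I A) x \<partial>PiM I (\<lambda>_. lborel))"
      using A by (intro emeasure_density) (auto intro!: sets_PiM_I_finite)
    also have "\<dots> = (\<integral>\<^sup>+x. (\<Prod>i\<in>I. f (x i) * indicator (A i) (x i)) \<partial>PiM I (\<lambda>_. lborel))"
    proof (rule nn_integral_cong)
      fix x assume "x \<in> space (PiM I (\<lambda>_. lborel :: real measure))"
      then have "x \<in> extensional I"
        by (simp add: space_PiM PiE_def)
      then have "indicator (Pi\<^sub>E I A) x = (\<Prod>i\<in>I. indicator (A i) (x i) :: ennreal)"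
        by (auto simp: indicator_def PiE_def Pi_def prod_zero_iff)
      then show "(\<Prod>i\<in>I. f (x i)) * indicator (Pi\<^sub>E I A) x = (\<Prod>i\<in>I. f (x i) * indicator (A i) (x i))"
        by (simp add: prod.distrib)
    qed
    also have "\<dots> = (\<Prod>i\<in>I. \<integral>\<^sup>+x. f x * indicator (A i) x \<partial>lborel)"
      using A by (intro L.product_nn_integral_prod) auto
    also have "\<dots> = (\<Prod>i\<in>I. emeasure (density lborel f) (A i))"
      using A by (intro prod.cong) (auto simp: emeasure_density)
    finally show "emeasure (density (PiM I (\<lambda>_. lborel)) (\<lambda>x. \<Prod>i\<in>I. f (x i))) (Pi\<^sub>E I A) =
        (\<Prod>i\<in>I. emeasure (density lborel f) (A i))" .
  qed simp
qed

lemma distr_PiM_lborel_shift: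
  fixes s :: real
  assumes [simp]: "finite I"
  shows "distr (PiM I (\<lambda>_. lborel)) (PiM I (\<lambda>_. lborel)) (\<lambda>x. \<lambda>i\<in>I. x i + s) = PiM I (\<lambda>_. lborel)"
proof -
  interpret L: product_sigma_finite "\<lambda>_. lborel :: real measure" by standard
  have meas: "(\<lambda>x. \<lambda>i\<in>I. x i + s) \<in> measurable (PiM I (\<lambda>_. lborel)) (PiM I (\<lambda>_. lborel))"
    by measurable
  show ?thesis
  proof (rule L.PiM_eqI)
    fix A :: "_ \<Rightarrow> real set" assume A: "\<And>i. i \<in> I \<Longrightarrow> A i \<in> sets lborel"
    have "(\<lambda>x. \<lambda>i\<in>I. x i + s) -` Pi\<^sub>E I A \<inter> space (PiM I (\<lambda>_. lborel)) = Pi\<^sub>E I (\<lambda>i. (\<lambda>x. s + x) -` A i)"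
      by (auto simp: space_PiM PiE_def Pi_def add.commute)
    moreover have "(\<lambda>x. s + x) -` A i \<in> sets lborel" if "i \<in> I" for i
      using measurable_sets[of "\<lambda>x. s + x" borel borel "A i"] A[OF that] by simp
    moreover have "emeasure lborel ((\<lambda>x. s + x) -` A i) = emeasure lborel (A i)" if "i \<in> I" for i
      using A[OF that] by (subst (2) lborel_distr_plus[of s, symmetric], subst emeasure_distr) auto
    moreover have "Pi\<^sub>E I A \<in> sets (PiM I (\<lambda>_. lborel))"
      using A by (intro sets_PiM_I_finite) auto
    ultimately show "emeasure (distr (PiM I (\<lambda>_. lborel)) (PiM I (\<lambda>_. lborel)) (\<lambda>x. \<lambda>i\<in>I. x i + s)) (Pi\<^sub>E I A)
        = (\<Prod>i\<in>I. emeasure lborel (A i))"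
      by (simp add: emeasure_distr[OF meas] L.emeasure_PiM)
  qed simp_all
qed

text \<open>Such a set has at most one point; countability is the form used for null sets on
  lines.\<close>

lemma countable_if_no_less_pair:
  fixes S :: "real set"
  assumes "\<And>s s'. s \<in> S \<Longrightarrow> s' \<in> S \<Longrightarrow> s < s' \<Longrightarrow> False"
  shows "countable S"
proof (cases "S = {}")
  case False
  then obtain s where "s \<in> S" by blast
  with assms have "S \<subseteq> {s}" by (metis linorder_less_linear singletonI subsetI)
  then show ?thesis by (rule countable_subset) simp
qed simp

text \<open>Average the measure of \<open>B\<close> over all diagonal shifts. Invariance makes the
  average constant, while exchanging the integrals leaves the length of a countable set on each
  line.\<close>

lemma PiM_lborel_null_if_countable_on_diagonal_lines:
  assumes [simp]: "finite I" and B [measurable]: "B \<in> sets (PiM I (\<lambda>_. lborel :: real measure))"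
    and countable: "\<And>x. countable {s. (\<lambda>i\<in>I. x i + s) \<in> B}"
  shows "emeasure (PiM I (\<lambda>_. lborel)) B = 0"
proof -
  interpret L: product_sigma_finite "\<lambda>_. lborel :: real measure" by standard
  let ?P = "PiM I (\<lambda>_. lborel :: real measure)"
  interpret P: sigma_finite_measure ?P
    by (rule L.sigma_finite) simp
  interpret pair_sigma_finite "lborel :: real measure" ?P by standard
  have meas: "(\<lambda>x. \<lambda>i\<in>I. x i + s) \<in> measurable ?P ?P" for s
    by measurable
  have [measurable]: "(\<lambda>(s, x). indicator B (\<lambda>i\<in>I. x i + s) :: ennreal) \<in> borel_measurable (lborel \<Otimes>\<^sub>M ?P)"
    by measurable
  \<comment> \<open>The factor is the length of the whole line, so the product can vanish only if
    \<open>B\<close> is null.\<close>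
  have "emeasure ?P B * \<infinity> = (\<integral>\<^sup>+(s::real). emeasure ?P B \<partial>lborel)"
    by (simp add: mult.commute)
  also have "\<dots> = (\<integral>\<^sup>+s. \<integral>\<^sup>+x. indicator B (\<lambda>i\<in>I. x i + s) \<partial>?P \<partial>lborel)"
  proof (rule nn_integral_cong)
    fix s :: real
    have "emeasure ?P B = (\<integral>\<^sup>+x. indicator B x \<partial>distr ?P ?P (\<lambda>x. \<lambda>i\<in>I. x i + s))"
      by (simp add: distr_PiM_lborel_shift)
    also have "\<dots> = (\<integral>\<^sup>+x. indicator B (\<lambda>i\<in>I. x i + s) \<partial>?P)"
      by (intro nn_integral_distr meas) auto
    finally show "emeasure ?P B = (\<integral>\<^sup>+x. indicator B (\<lambda>i\<in>I. x i + s) \<partial>?P)" .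
  qed
  also have "\<dots> = (\<integral>\<^sup>+x. \<integral>\<^sup>+s. indicator B (\<lambda>i\<in>I. x i + s) \<partial>lborel \<partial>?P)"
    by (rule Fubini'[symmetric]) simp
  also have "\<dots> = (\<integral>\<^sup>+x. 0 \<partial>?P)"
  proof (rule nn_integral_cong)
    fix x :: "_ \<Rightarrow> real"
    let ?S = "{s. (\<lambda>i\<in>I. x i + s) \<in> B}"
    have "(\<integral>\<^sup>+s. indicator B (\<lambda>i\<in>I. x i + s) \<partial>lborel) = (\<integral>\<^sup>+s. indicator ?S s \<partial>lborel)"
      by (intro nn_integral_cong) (simp add: indicator_def)
    also have "\<dots> = emeasure lborel ?S"
      by (intro nn_integral_indicator) (use countable[of x] in \<open>auto intro: sets.countable\<close>)
    also have "\<dots> = 0"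
      using countable[of x] by (rule emeasure_lborel_countable)
    finally show "(\<integral>\<^sup>+s. indicator B (\<lambda>i\<in>I. x i + s) \<partial>lborel) = 0" .
  qed
  finally show ?thesis by (simp add: ennreal_mult_top split: if_splits)
qed

section \<open>Joint law of the independent normal errors\<close>

lemma (in prob_space) distr_indep_normal:
  fixes X :: "'i \<Rightarrow> 'a \<Rightarrow> real"
  assumes I: "finite I" "I \<noteq> {}" and "0 < \<sigma>" and indep: "indep_vars (\<lambda>_. borel) X I"
    and normal: "\<And>i. i \<in> I \<Longrightarrow> distributed M lborel (X i) (normal_density 0 \<sigma>)"
  shows "distr M (PiM I (\<lambda>_. borel)) (\<lambda>\<omega>. \<lambda>i\<in>I. X i \<omega>) =
           density (PiM I (\<lambda>_. lborel)) (\<lambda>x. \<Prod>i\<in>I. normal_density 0 \<sigma> (x i))"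
proof -
  have rv: "random_variable borel (X i)" if "i \<in> I" for i
    using distributed_measurable[OF normal[OF that]] by simp
  have "distr M (PiM I (\<lambda>_. borel)) (\<lambda>\<omega>. \<lambda>i\<in>I. X i \<omega>) = PiM I (\<lambda>i. distr M borel (X i))"
    using indep_vars_iff_distr_eq_PiM'[OF I(2) rv] indep by simp
  also have "\<dots> = PiM I (\<lambda>_. density lborel (normal_density 0 \<sigma>))"
  proof (rule PiM_cong)
    fix i assume "i \<in> I"
    from distributed_distr_eq_density[OF normal[OF this]]
    show "distr M borel (X i) = density lborel (normal_density 0 \<sigma>)"
      by (metis distr_cong sets_lborel)
  qed simp
  also have "\<dots> = density (PiM I (\<lambda>_. lborel)) (\<lambda>x. \<Prod>i\<in>I. normal_density 0 \<sigma> (x i))"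
    using prob_space_normal_density[of \<sigma> 0] \<open>0 < \<sigma>\<close> I(1)
    by (subst PiM_density_eq) (auto simp: prod_ennreal)
  finally show ?thesis .
qed

text \<open>The negated errors are again independent with the same centred density, and these data
  determine the joint law.\<close>

lemma (in prob_space) distr_indep_normal_uminus:
  fixes X :: "'i \<Rightarrow> 'a \<Rightarrow> real"
  assumes I: "finite I" "I \<noteq> {}" and \<sigma>: "0 < \<sigma>" and indep: "indep_vars (\<lambda>_. borel) X I"
    and normal: "\<And>i. i \<in> I \<Longrightarrow> distributed M lborel (X i) (normal_density 0 \<sigma>)"
  shows "distr M (PiM I (\<lambda>_. borel)) (\<lambda>\<omega>. \<lambda>i\<in>I. - X i \<omega>) =
           distr M (PiM I (\<lambda>_. borel)) (\<lambda>\<omega>. \<lambda>i\<in>I. X i \<omega>)"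
proof -
  have "indep_vars (\<lambda>_. borel) (\<lambda>i \<omega>. - X i \<omega>) I"
    by (rule indep_vars_compose2[OF indep]) simp
  moreover have "distributed M lborel (\<lambda>\<omega>. - X i \<omega>) (normal_density 0 \<sigma>)" if "i \<in> I" for i
    using normal_density_affine[OF normal[OF that] \<sigma>, of "-1" 0] by simp
  ultimately show ?thesis
    using distr_indep_normal[OF I \<sigma>] indep normal by simp
qed

section \<open>Moment vectors\<close>

text \<open>The confidence statement depends on a measure only through this vector, so the
  quantifier over measures becomes one over a set in a finite-dimensional space.\<close>

definition moments :: "real set \<Rightarrow> (real ^ 'm::{finite,linorder}) set" where
  "moments T = {LINT s|\<mu>. psi s | \<mu>. measure_on T \<mu> \<and> emeasure \<mu> T \<noteq> 0 \<and>
     integrable \<mu> (psi :: real \<Rightarrow> real ^ 'm::{finite,linorder})}"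

lemma momentsE:
  fixes m :: "real ^ 'm::{finite,linorder}"
  assumes "m \<in> moments T"
  obtains \<mu> where "space \<mu> = T" "emeasure \<mu> T \<noteq> 0"
    "\<And>b :: real ^ 'm::{finite,linorder}. integrable \<mu> (\<lambda>s. polyf b s)"
    "\<And>b. b \<bullet> m = (LINT s|\<mu>. polyf b s)"
proof -
  from assms obtain \<mu> where \<mu>: "measure_on T \<mu>" "emeasure \<mu> T \<noteq> 0"
    "integrable \<mu> (psi :: real \<Rightarrow> real ^ 'm::{finite,linorder})" "m = (LINT s|\<mu>. psi s)"
    by (auto simp: moments_def)
  have "space \<mu> = T"
    using sets_eq_imp_space_eq[OF \<mu>(1)[unfolded measure_on_def]] by (simp add: space_restrict_space)
  with \<mu> show thesis
    by (intro that[of \<mu>]) (auto simp: polyf_def)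
qed

lemma confidence_statement_iff:
  "confidence_statement T S q c x \<longleftrightarrow> (\<forall>m\<in>moments T. (x - c) \<bullet> m < sqrt q * qnorm S m)"
  unfolding confidence_statement_def moments_def polyf_def
  by (fastforce simp: inner_diff_left)

lemma inner_moment_nonneg: "p \<in> nonneg_cone T \<Longrightarrow> m \<in> moments T \<Longrightarrow> 0 \<le> p \<bullet> m"
  by (erule momentsE) (auto simp: nonneg_cone_def intro!: integral_nonneg_AE)

text \<open>The least index carries exponent 0, so this is the polynomial 1. It is the direction in
  which all moment inequalities can be made strict at once.\<close>

definition const_poly :: "real ^ 'm::{finite,linorder}" where
  "const_poly = axis (Min UNIV) 1"

lemma polyf_const_poly [simp]: "polyf (const_poly :: real ^ 'm::{finite,linorder}) s = 1"
proof -
  have "expo (Min UNIV :: 'm::{finite,linorder}) = 0"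
    by (auto simp: expo_def not_less)
  then show ?thesis
    by (simp add: polyf_def const_poly_def inner_axis' psi_def)
qed

lemma polyf_scaleR: "polyf (r *\<^sub>R b) s = r * polyf b s"
  by (simp add: polyf_def)

text \<open>The pairing is the total mass of \<mu>. Integrability of the polynomial 1 makes it
  finite, which matters because \<open>measure\<close> is 0 on infinite mass.\<close>

lemma inner_const_poly_moment_pos:
  fixes m :: "real ^ 'm::{finite,linorder}"
  assumes "m \<in> moments T"
  shows "0 < const_poly \<bullet> m"
proof -
  from assms obtain \<mu> where \<mu>: "space \<mu> = T" "emeasure \<mu> T \<noteq> 0"
    "\<And>b :: real ^ 'm::{finite,linorder}. integrable \<mu> (\<lambda>s. polyf b s)" "\<And>b. b \<bullet> m = (LINT s|\<mu>. polyf b s)"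
    by (rule momentsE) blast
  from \<mu>(3)[of const_poly] have "emeasure \<mu> T < \<infinity>"
    by (simp add: integrable_iff_bounded \<mu>(1))
  then show ?thesis
    using \<mu>(1,2) by (simp add: \<mu>(4) measure_def enn2real_positive_iff zero_less_iff_neq_zero)
qed

text \<open>A constant added to all data is itself a polynomial, which least squares reproduces.
  Diagonal lines in noise space thus become lines along \<open>const_poly\<close>.\<close>

lemma lse_shift:
  assumes "invertible (gram N t :: real ^ 'm::{finite,linorder} ^ 'm::{finite,linorder})"
  shows "lse N t (\<lambda>h\<in>{1..N}. y h + s) = lse N t y + s *\<^sub>R (const_poly :: real ^ 'm::{finite,linorder})"
proof -
  have "(lse N t (\<lambda>h\<in>{1..N}. y h + s) :: real ^ 'm::{finite,linorder}) =
      lse N t (\<lambda>h. y h + polyf (s *\<^sub>R const_poly :: real ^ 'm::{finite,linorder}) (t h))"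
    by (rule lse_cong) (simp add: polyf_scaleR)
  then show ?thesis
    by (simp only: lse_add lse_polyf[OF assms])
qed

lemma psi_measurable [measurable]: "(psi :: real \<Rightarrow> real ^ 'm::{finite,linorder}) \<in> borel_measurable borel"
  unfolding psi_def by (intro borel_measurable_continuous_onI continuous_intros)

text \<open>The vector comes from the discrete measure with weight \<open>a s\<close> at
  \<open>s\<close>, pushed forward to the Borel sets of \<open>T\<close>.\<close>

lemma sum_psi_in_moments:
  assumes F: "finite F" "F \<noteq> {}" "F \<subseteq> T" and a: "\<And>s. s \<in> F \<Longrightarrow> 0 < a s"
  shows "(\<Sum>s\<in>F. a s *\<^sub>R psi s) \<in> (moments T :: (real ^ 'm::{finite,linorder}) set)"
proof -
  let ?P = "point_measure F (\<lambda>s. ennreal (a s))"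
  define \<mu> where "\<mu> = distr ?P (restrict_space borel T) (\<lambda>s. s)"
  have id: "(\<lambda>s. s) \<in> measurable ?P (restrict_space borel T)"
    using F(3) by (auto simp: measurable_point_measure_eq1 space_restrict_space)
  have psi: "(psi :: real \<Rightarrow> real ^ 'm::{finite,linorder}) \<in> borel_measurable (restrict_space borel T)"
    by (intro measurable_restrict_space1) measurable
  have "emeasure \<mu> T = emeasure ?P F"
    using F(3) sets.top[of "restrict_space borel T"]
    unfolding \<mu>_def by (subst emeasure_distr[OF id])
      (auto simp: space_restrict_space space_point_measure Int_absorb1 intro!: arg_cong[where f = "emeasure ?P"])
  also have "\<dots> = ennreal (\<Sum>s\<in>F. a s)"
    using F(1) a by (simp add: emeasure_point_measure_finite less_imp_le sum_ennreal)
  finally have "emeasure \<mu> T \<noteq> 0"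
    using sum_pos[of F a] F a by simp
  moreover have "integrable \<mu> (psi :: real \<Rightarrow> real ^ 'm::{finite,linorder})"
    unfolding \<mu>_def integrable_distr_eq[OF id psi] by (rule integrable_point_measure_finite[OF F(1)])
  moreover have "(LINT s|\<mu>. psi s) = (\<Sum>s\<in>F. a s *\<^sub>R (psi s :: real ^ 'm::{finite,linorder}))"
    unfolding \<mu>_def integral_distr[OF id psi]
    by (rule lebesgue_integral_point_measure_finite[OF F(1)]) (use a in \<open>auto intro: less_imp_le\<close>)
  moreover have "measure_on T \<mu>"
    by (simp add: measure_on_def \<mu>_def)
  ultimately show ?thesis
    unfolding moments_def by (intro CollectI exI[of _ \<mu>]) simp
qed

text \<open>Points of the hull are finite nonnegative combinations of values of \<open>psi\<close>.
  Dropping zero weights leaves a nonzero discrete measure or, if nothing remains, the vector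
  0.\<close>

lemma conic_convex_hull_subset_moments:
  "conic hull (convex hull (psi ` T)) \<subseteq> insert (0 :: real ^ 'm::{finite,linorder}) (moments T)"
proof
  fix x :: "real ^ 'm::{finite,linorder}"
  assume "x \<in> conic hull (convex hull (psi ` T))"
  then obtain r V u where r: "0 \<le> r" and V: "finite V" "V \<subseteq> psi ` T" "\<forall>v\<in>V. 0 \<le> u v"
    and x: "x = r *\<^sub>R (\<Sum>v\<in>V. u v *\<^sub>R v)"
    unfolding conic_hull_explicit convex_hull_explicit by blast
  from V(2) obtain F where F: "F \<subseteq> T" "inj_on (psi :: real \<Rightarrow> real ^ 'm::{finite,linorder}) F" "V = psi ` F"
    by (auto simp: subset_image_inj)
  define G where "G = {s \<in> F. r * u (psi s) \<noteq> 0}"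
  have "finite F" using V(1) F(2,3) by (simp add: finite_image_iff)
  have "x = (\<Sum>s\<in>F. (r * u (psi s)) *\<^sub>R psi s)"
    by (simp add: x F(3) sum.reindex[OF F(2)] scaleR_sum_right)
  also have "\<dots> = (\<Sum>s\<in>G. (r * u (psi s)) *\<^sub>R psi s)"
    using \<open>finite F\<close> by (intro sum.mono_neutral_right) (auto simp: G_def)
  finally have x: "x = (\<Sum>s\<in>G. (r * u (psi s)) *\<^sub>R psi s)" .
  show "x \<in> insert 0 (moments T)"
  proof (cases "G = {}")
    case False
    have "0 < r * u (psi s)" if "s \<in> G" for s
      using that r V(3) F(3) by (auto simp: G_def less_le)
    then have "x \<in> moments T"
      unfolding x using False F(1) \<open>finite F\<close> by (intro sum_psi_in_moments) (auto simp: G_def)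
    then show ?thesis by simp
  qed (simp add: x)
qed

text \<open>Bipolar argument: a hyperplane separating \<open>z\<close> from the closed cone spanned
  by the curve \<open>psi\<close> would have a normal in \<open>nonneg_cone T\<close> that pairs
  negatively with \<open>z\<close>.\<close>

lemma dual_nonneg_cone:
  fixes z :: "real ^ 'm::{finite,linorder}"
  assumes "T \<noteq> {}" and z: "\<And>p. p \<in> nonneg_cone T \<Longrightarrow> 0 \<le> z \<bullet> p"
  shows "z \<in> closure (insert 0 (moments T))"
proof -
  let ?D = "conic hull (convex hull (psi ` T)) :: (real ^ 'm::{finite,linorder}) set"
  have "z \<in> closure ?D"
  proof (rule ccontr)
    assume "z \<notin> closure ?D"
    moreover have "convex (closure ?D)"
      by (intro convex_closure convex_conic_hull convex_convex_hull)
    ultimately obtain a b where ab: "a \<bullet> z < b" "\<forall>x\<in>closure ?D. b < a \<bullet> x"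
      using separating_hyperplane_closed_point[of "closure ?D" z] by auto
    have "0 \<in> closure ?D"
      using \<open>T \<noteq> {}\<close> by (intro subsetD[OF closure_subset]) simp
    with ab(2) have b: "b < 0" by force
    have "0 \<le> a \<bullet> psi s" if "s \<in> T" for s
    proof (rule ccontr)
      assume neg: "\<not> 0 \<le> a \<bullet> psi s"
      \<comment> \<open>This positive multiple puts the ray through \<open>psi s\<close> exactly on
        the hyperplane of level \<open>b\<close>.\<close>
      have "(b / (a \<bullet> psi s)) *\<^sub>R psi s \<in> ?D"
        unfolding conic_hull_explicit using neg b that
        by (auto intro!: exI[of _ "b / (a \<bullet> psi s)"] exI[of _ "psi s"] hull_inc divide_nonpos_neg)
      then have "b < a \<bullet> ((b / (a \<bullet> psi s)) *\<^sub>R psi s)"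
        using ab(2) closure_subset by blast
      then show False using neg by simp
    qed
    then have "0 \<le> z \<bullet> a"
      by (intro z) (simp add: nonneg_cone_def polyf_def)
    then show False
      using ab(1) b by (simp add: inner_commute)
  qed
  then show ?thesis
    using closure_mono[OF conic_convex_hull_subset_moments] by blast
qed

section \<open>The likelihood ratio statistic\<close>

lemma closed_nonneg_cone: "closed (nonneg_cone T :: (real ^ 'm::{finite,linorder}) set)"
proof -
  have "nonneg_cone T = (\<Inter>s\<in>T. {b :: real ^ 'm::{finite,linorder}. 0 \<le> b \<bullet> psi s})"
    by (auto simp: nonneg_cone_def polyf_def)
  then show ?thesis
    by (auto intro!: closed_INT closed_Collect_le continuous_intros)
qed

context
  fixes Q :: "real ^ 'm::{finite,linorder} ^ 'm::{finite,linorder}"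
  assumes pd: "pos_def_matrix Q"
begin

interpretation pos_def_matrix Q by (rule pd)

lemmas qproj_nonneg_cone = qproj_cone[where A = "nonneg_cone T" for T, OF closed_nonneg_cone]

text \<open>Pythagoras for the Moreau decomposition: the statistic is the squared distance to the
  cone.\<close>

lemma lambda12_eq:
  "lambda12 T (matrix_inv Q) x = (qnorm Q (x - qproj Q x (nonneg_cone T)))\<^sup>2"
  unfolding lambda12_def matrix_inv_inv
  by (rule qproj_nonneg_cone(4)) (auto simp: nonneg_cone_def polyf_def inner_add_left)

text \<open>Distance to a cone by duality: Cauchy-Schwarz bounds every pairing by the distance, and
  the polar part of \<open>x\<close> attains equality.\<close>

lemma lambda12_le_iff:
  assumes T: "T \<noteq> {}" and q: "0 \<le> q"
  shows "lambda12 T (matrix_inv Q) x \<le> q \<longleftrightarrow>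
    (\<forall>m\<in>moments T. (- x) \<bullet> m \<le> sqrt q * qnorm (matrix_inv Q) m)"
proof -
  define p where "p = qproj Q x (nonneg_cone T)"
  define d where "d = qnorm Q (x - p)"
  have lam: "lambda12 T (matrix_inv Q) x = d\<^sup>2"
    by (simp add: lambda12_eq d_def p_def)
  have d: "0 \<le> d" by (simp add: d_def qnorm_nonneg)
  have p: "p \<in> nonneg_cone T" "p \<bullet> (Q *v (x - p)) = 0"
    "\<And>y. y \<in> nonneg_cone T \<Longrightarrow> y \<bullet> (Q *v (x - p)) \<le> 0"
    unfolding p_def
    by (rule qproj_nonneg_cone; auto simp: nonneg_cone_def polyf_def inner_add_left)+
  show ?thesis
  proof
    assume "lambda12 T (matrix_inv Q) x \<le> q"
    then have dq: "d \<le> sqrt q"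
      using d by (simp add: lam real_le_rsqrt)
    show "\<forall>m\<in>moments T. (- x) \<bullet> m \<le> sqrt q * qnorm (matrix_inv Q) m"
    proof
      fix m :: "real ^ 'm::{finite,linorder}" assume m: "m \<in> moments T"
      have "(- x) \<bullet> m \<le> (- (x - p)) \<bullet> m"
        using inner_moment_nonneg[OF p(1) m] by (simp add: inner_diff_left)
      also have "\<dots> \<le> qnorm Q (- (x - p)) * qnorm (matrix_inv Q) m"
        by (rule cauchy_schwarz_dual)
      also have "qnorm Q (- (x - p)) = d"
        using quadratic_diff[of 0 1 "x - p"] by (simp add: d_def qnorm_def)
      also have "d * qnorm (matrix_inv Q) m \<le> sqrt q * qnorm (matrix_inv Q) m"
        using dq inner_const_poly_moment_pos[OF m] qnorm_inv_pos[of m]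
        by (intro mult_right_mono) (cases "m = 0"; auto)+
      finally show "(- x) \<bullet> m \<le> sqrt q * qnorm (matrix_inv Q) m" .
    qed
  next
    assume bound: "\<forall>m\<in>moments T. (- x) \<bullet> m \<le> sqrt q * qnorm (matrix_inv Q) m"
    \<comment> \<open>The extremal test vector. It need not be a moment vector itself, only a limit
      of such vectors or 0, so the bound is first extended to the closure.\<close>
    define z where "z = Q *v (p - x)"
    have z_neg: "z = - (Q *v (x - p))"
      by (simp add: z_def matrix_vector_mult_diff_distrib)
    have "insert 0 (moments T) \<subseteq> {m. (- x) \<bullet> m \<le> sqrt q * qnorm (matrix_inv Q) m}"
      using bound q by (auto simp: qnorm_def)
    moreover have "closed {m. (- x) \<bullet> m \<le> sqrt q * qnorm (matrix_inv Q) m}"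
      by (intro closed_Collect_le continuous_intros)
    ultimately have "closure (insert 0 (moments T)) \<subseteq> {m. (- x) \<bullet> m \<le> sqrt q * qnorm (matrix_inv Q) m}"
      by (rule closure_minimal)
    moreover have "z \<in> closure (insert 0 (moments T))"
      using p(3) by (intro dual_nonneg_cone T) (simp add: z_neg inner_commute)
    ultimately have "(- x) \<bullet> z \<le> sqrt q * qnorm (matrix_inv Q) z"
      by blast
    moreover have "qnorm (matrix_inv Q) z = d"
      using qnorm_inv[of "p - x"] quadratic_diff[of 0 1 "x - p"] by (simp add: z_def d_def qnorm_def)
    moreover have "(- x) \<bullet> z = d\<^sup>2"
      using p(2) by (simp add: z_neg d_def qnorm_power2 inner_diff_left)
    \<comment> \<open>The bound at \<open>z\<close> reads \<open>d\<^sup>2 \<le> sqrt q * d\<close>;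
      cancelling \<open>d\<close> requires \<open>d \<noteq> 0\<close>.\<close>
    ultimately have "d \<le> sqrt q"
      using d q by (cases "d = 0") (auto simp: power2_eq_square)
    then show "lambda12 T (matrix_inv Q) x \<le> q"
      using d q by (simp add: lam real_sqrt_le_iff sqrt_le_D real_le_rsqrt)
        (metis power_mono real_sqrt_pow2)
  qed
qed

end

theorem proposition2p3:
  fixes M :: "'a measure"
    and \<epsilon> :: "nat \<Rightarrow> 'a \<Rightarrow> real"
    and T :: "real set"
    and t :: "nat \<Rightarrow> real"
    and c :: "real ^ 'm::{finite,linorder}"
    and n N :: nat
    and \<sigma> \<alpha> lam :: real
  assumes "CARD('m) = n + 1" and "n \<ge> 1"
    and "prob_space M"
    and "\<sigma> > 0"
    and "prob_space.indep_vars M (\<lambda>_. borel) \<epsilon> {1..N}"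
    and "\<And>h. h \<in> {1..N} \<Longrightarrow> distributed M lborel (\<epsilon> h) (normal_density 0 \<sigma>)"
    and "\<And>h. h \<in> {1..N} \<Longrightarrow> t h \<in> T"
    and "invertible (gram N t :: real ^ 'm::{finite,linorder} ^ 'm::{finite,linorder})"
    and "0 < \<alpha>" and "\<alpha> < 1"
    and "is_upper_percentile M
           (\<lambda>\<omega>. lambda12 T (covm \<sigma> N t) (chat N t \<epsilon> (0 :: real ^ 'm::{finite,linorder}) \<omega>)) \<alpha> lam"
  shows "{\<omega> \<in> space M. confidence_statement T (covm \<sigma> N t) lam c (chat N t \<epsilon> c \<omega>)}
           \<in> sets (completion M) \<and>
         measure (completion M)
           {\<omega> \<in> space M. confidence_statement T (covm \<sigma> N t) lam c (chat N t \<epsilon> c \<omega>)}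
         = 1 - \<alpha>"
proof -
  note inv = assms(8)
  interpret prob_space M by fact
  let ?S = "covm \<sigma> N t :: real ^ 'm::{finite,linorder} ^ 'm::{finite,linorder}"
  let ?I = "{1..N}"
  define Q where "Q = (1 / \<sigma>\<^sup>2) *\<^sub>R (gram N t :: real ^ 'm::{finite,linorder} ^ 'm::{finite,linorder})"
  have pd: "pos_def_matrix Q"
    unfolding Q_def using \<open>0 < \<sigma>\<close> by (intro pos_def_gram inv) simp
  have S: "?S = matrix_inv Q"
    unfolding Q_def using covm_eq[OF inv \<open>0 < \<sigma>\<close>] .
  interpret Q: pos_def_matrix Q by (rule pd)
  \<comment> \<open>With no observations the form of \<open>Q\<close> would vanish on this vector,
    so \<open>N\<close> is positive and \<open>T\<close> contains a design point.\<close>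
  have "const_poly \<noteq> (0 :: real ^ 'm::{finite,linorder})"
    by (simp add: const_poly_def axis_eq_0_iff)
  from Q.pos[OF this] have I: "?I \<noteq> {}"
    by (intro notI) (simp add: Q_def scaleR_matrix_vector_assoc[symmetric] inner_gram)
  then have T: "T \<noteq> {}" using assms(7) by blast

  define e where "e \<omega> = (lse N t (\<lambda>h. \<epsilon> h \<omega>) :: real ^ 'm::{finite,linorder})" for \<omega>
  define A where "A = {x :: real ^ 'm::{finite,linorder}. \<forall>m\<in>moments T. x \<bullet> m \<le> sqrt lam * qnorm ?S m}"
  \<comment> \<open>Points that remain in \<open>A\<close> after some upward step. Steps
    \<open>1 / real (Suc k)\<close> suffice and make \<open>U\<close> a countable union of closed
    sets, hence Borel.\<close>
  define U where "U = (\<Union>k. {x. x + (1 / real (Suc k)) *\<^sub>R const_poly \<in> A})"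
  define E where "E = {\<omega> \<in> space M. confidence_statement T ?S lam c (chat N t \<epsilon> c \<omega>)}"
  have E: "E = {\<omega> \<in> space M. \<forall>m\<in>moments T. e \<omega> \<bullet> m < sqrt lam * qnorm ?S m}"
    by (simp add: E_def confidence_statement_iff chat_eq[OF inv] e_def)

  have A_Inter: "A = (\<Inter>m\<in>moments T. {x. x \<bullet> m \<le> sqrt lam * qnorm ?S m})"
    by (auto simp: A_def)
  have closed_A: "closed A"
    unfolding A_Inter by (intro closed_INT ballI closed_Collect_le continuous_intros)
  have [measurable]: "A \<in> sets borel" "U \<in> sets borel"
    using closed_A unfolding U_def
    by (auto intro!: borel_closed sets.countable_UN closed_vimage[unfolded vimage_def] continuous_intros)
  have A_down: "x - r *\<^sub>R const_poly \<in> A" if "x \<in> A" "0 \<le> r" for x r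
    unfolding A_def
  proof safe
    fix m :: "real ^ 'm::{finite,linorder}" assume m: "m \<in> moments T"
    then have "0 \<le> r * (const_poly \<bullet> m)"
      using inner_const_poly_moment_pos[OF m] that(2) by simp
    moreover have "x \<bullet> m \<le> sqrt lam * qnorm ?S m"
      using that(1) m by (simp add: A_def)
    ultimately show "(x - r *\<^sub>R const_poly) \<bullet> m \<le> sqrt lam * qnorm ?S m"
      by (simp add: inner_diff_left)
  qed
  have U_strict: "x \<bullet> m < sqrt lam * qnorm ?S m" if x: "x \<in> U" and m: "m \<in> moments T" for x m
  proof -
    from x obtain k where "x + (1 / real (Suc k)) *\<^sub>R const_poly \<in> A"
      by (auto simp: U_def)
    then have "x \<bullet> m + (1 / real (Suc k)) * (const_poly \<bullet> m) \<le> sqrt lam * qnorm ?S m"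
      using m by (auto simp: A_def inner_add_left)
    moreover have "0 < (1 / real (Suc k)) * (const_poly \<bullet> m)"
      using inner_const_poly_moment_pos[OF m] by simp
    ultimately show ?thesis by linarith
  qed

  \<comment> \<open>The noise vector in the product space and its law\<close>
  have rv: "random_variable borel (\<epsilon> h)" if "h \<in> ?I" for h
    using distributed_measurable[OF assms(6)[OF that]] by simp
  define X where "X \<omega> = (\<lambda>h\<in>?I. \<epsilon> h \<omega>)" for \<omega>
  have X: "X \<in> measurable M (PiM ?I (\<lambda>_. borel))"
    unfolding X_def by (intro measurable_restrict rv)
  have X': "(\<lambda>\<omega>. \<lambda>h\<in>?I. - \<epsilon> h \<omega>) \<in> measurable M (PiM ?I (\<lambda>_. borel))"
    by (intro measurable_restrict borel_measurable_uminus rv)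
  have e_X: "e \<omega> = lse N t (X \<omega>)" for \<omega>
    unfolding e_def X_def by (rule lse_cong) simp
  have e_X': "- e \<omega> = lse N t (\<lambda>h\<in>?I. - \<epsilon> h \<omega>)" for \<omega>
    unfolding e_def lse_uminus[symmetric] by (rule lse_cong) simp
  note [measurable] = measurable_lse[of N t, where 'm = 'm]
  have [measurable]: "e \<in> borel_measurable M"
    unfolding e_X[abs_def] by (rule measurable_compose[OF X measurable_lse])
  have normal: "distr M (PiM ?I (\<lambda>_. borel)) X =
      density (PiM ?I (\<lambda>_. lborel)) (\<lambda>x. \<Prod>i\<in>?I. normal_density 0 \<sigma> (x i))"
    unfolding X_def by (intro distr_indep_normal I assms) auto

  \<comment> \<open>The percentile controls \<open>- e\<close>, whereas coverage concerns
    \<open>e\<close>; \<open>A\<close> need not be symmetric, but the law of the noise is.\<close>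
  have symm: "prob {\<omega> \<in> space M. - e \<omega> \<in> A} = prob {\<omega> \<in> space M. e \<omega> \<in> A}"
  proof -
    let ?P = "PiM ?I (\<lambda>_. borel :: real measure)"
    let ?B = "{y \<in> space ?P. (lse N t y :: real ^ 'm::{finite,linorder}) \<in> A}"
    have B: "?B \<in> sets ?P" by measurable
    have "prob {\<omega> \<in> space M. - e \<omega> \<in> A} = measure (distr M ?P (\<lambda>\<omega>. \<lambda>h\<in>?I. - \<epsilon> h \<omega>)) ?B"
      using measurable_space[OF X']
      by (subst measure_distr[OF X' B]) (auto simp: e_X' intro!: arg_cong[where f = prob])
    also have "\<dots> = measure (distr M ?P X) ?B"
      using distr_indep_normal_uminus[OF _ I \<open>0 < \<sigma>\<close> assms(5,6), folded X_def] by simp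
    also have "\<dots> = prob {\<omega> \<in> space M. e \<omega> \<in> A}"
      using measurable_space[OF X]
      by (subst measure_distr[OF X B]) (auto simp: e_X intro!: arg_cong[where f = prob])
    finally show ?thesis .
  qed

  have pct: "prob {\<omega> \<in> space M. lam < lambda12 T ?S (e \<omega>)} = \<alpha>"
    using assms(11) by (simp add: is_upper_percentile_def chat_eq[OF inv] e_def)
  \<comment> \<open>The statistic is a square, so a negative \<open>lam\<close> would be exceeded
    with probability 1.\<close>
  have "0 \<le> lam"
  proof (rule ccontr)
    assume "\<not> 0 \<le> lam"
    then have "lam < lambda12 T ?S (e \<omega>)" for \<omega>
      unfolding S lambda12_eq[OF pd] by (smt (verit) zero_le_power2)
    then show False using pct \<open>\<alpha> < 1\<close> by (simp add: prob_space)
  qed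
  have "{\<omega> \<in> space M. lam < lambda12 T ?S (e \<omega>)} = space M - {\<omega> \<in> space M. - e \<omega> \<in> A}"
    using lambda12_le_iff[OF pd T \<open>0 \<le> lam\<close>, folded S] by (auto simp: A_def not_le[symmetric])
  then have "prob {\<omega> \<in> space M. - e \<omega> \<in> A} = 1 - \<alpha>"
    using pct by (simp add: prob_compl)
  with symm have prob_A: "prob {\<omega> \<in> space M. e \<omega> \<in> A} = 1 - \<alpha>" by simp

  have null: "{\<omega> \<in> space M. e \<omega> \<in> A - U} \<in> null_sets M"
  proof -
    let ?P = "PiM ?I (\<lambda>_. borel :: real measure)" and ?L = "PiM ?I (\<lambda>_. lborel :: real measure)"
    let ?B = "{y \<in> space ?P. (lse N t y :: real ^ 'm::{finite,linorder}) \<in> A - U}"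
    have sets: "sets ?P = sets ?L" by (intro sets_PiM_cong) auto
    have B: "?B \<in> sets ?P" by measurable
    have "emeasure ?L ?B = 0"
    proof (rule PiM_lborel_null_if_countable_on_diagonal_lines)
      fix y :: "nat \<Rightarrow> real"
      show "countable {s. (\<lambda>h\<in>?I. y h + s) \<in> ?B}"
      proof (rule countable_if_no_less_pair, goal_cases)
        case (1 s s')
        let ?e = "\<lambda>s. lse N t y + s *\<^sub>R const_poly :: real ^ 'm::{finite,linorder}"
        have s: "?e s \<notin> U" and s': "?e s' \<in> A"
          using 1(1,2) by (auto simp: lse_shift[OF inv, simplified])
        obtain k where k: "1 / real (Suc k) < s' - s"
          using 1(3) by (metis diff_gt_0_iff_gt nat_approx_posE)
        \<comment> \<open>Moving down from \<open>?e s'\<close> lands just above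
          \<open>?e s\<close>, still inside \<open>A\<close>, which would put \<open>?e s\<close> in
          \<open>U\<close>.\<close>
        have "?e s' - (s' - s - 1 / real (Suc k)) *\<^sub>R const_poly \<in> A"
          using k by (intro A_down s') simp
        then have "?e s + (1 / real (Suc k)) *\<^sub>R const_poly \<in> A"
          by (simp add: algebra_simps)
        then show False using s by (auto simp: U_def)
      qed
    qed (use B sets in auto)
    with B sets have "?B \<in> null_sets ?L" by auto
    \<comment> \<open>The law of the noise has a density, so Lebesgue null sets are null for it
      too.\<close>
    from AE_not_in[OF this]
    have "AE y in ?L. y \<in> ?B \<longrightarrow> ennreal (\<Prod>i\<in>?I. normal_density 0 \<sigma> (y i)) = 0"
      by eventually_elim (rule impI, erule notE)
    moreover have "?B \<in> sets ?L" using B sets by simp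
    moreover have "(\<lambda>y. ennreal (\<Prod>i\<in>?I. normal_density 0 \<sigma> (y i))) \<in> borel_measurable ?L"
      by measurable
    ultimately have "?B \<in> null_sets (distr M ?P X)"
      unfolding normal by (simp only: null_sets_density_iff)
    then have "emeasure M (X -` ?B \<inter> space M) = 0"
      unfolding emeasure_distr[OF X B, symmetric] by (rule null_setsD1)
    also have "X -` ?B \<inter> space M = {\<omega> \<in> space M. e \<omega> \<in> A - U}"
      using measurable_space[OF X] by (auto simp: e_X)
    finally show ?thesis by (intro null_setsI) measurable
  qed

  let ?A = "{\<omega> \<in> space M. e \<omega> \<in> A}"
  \<comment> \<open>\<open>E\<close> is not shown to be measurable for \<open>M\<close>; it differs
    from \<open>?A\<close> by a subset of a null set, which the completion makes measurable.\<close>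
  have N: "?A - E \<in> null_sets (completion M)"
    by (rule null_sets_completion_subset[OF _ null_sets_completionI[OF null]])
       (use U_strict in \<open>auto simp: E\<close>)
  have E_A: "E = ?A - (?A - E)"
    by (auto simp: E A_def intro: less_imp_le)
  have A: "?A \<in> sets M" by measurable
  then have A': "?A \<in> sets (completion M)"
    by (rule sets_completionI_sets)
  have "E \<in> sets (completion M)"
    by (subst E_A) (rule sets.Diff[OF A' null_setsD2[OF N]])
  moreover have "measure (completion M) E = measure (completion M) ?A"
    by (subst E_A) (rule measure_Diff_null_set[OF A' N])
  ultimately have "E \<in> sets (completion M) \<and> measure (completion M) E = 1 - \<alpha>"
    using prob_A A by simp
  then show ?thesis by (simp add: E_def)
qed

end
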